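(* Let $p$ be a prime, $\mathbb{C}_p$ the completion of an algebraic closure of $\mathbb{Q}_p$, $k\in\mathbb{Z}$, and $\lambda\in\mathbb{C}_p$ with $\lambda\neq0$. Define the formal power series $$G(t)=\frac{\mathrm{Li}_{k}\left(1-(1+\lambda t)^{-\frac{1}{\lambda}}\right)}{(1+\lambda t)^{\frac{1}{\lambda}}-1},\qquad F(t)=\frac{(e^{t}-1)\,\mathrm{Li}_{k}\left(1-(1+\lambda t)^{-\frac{1}{\lambda}}\right)}{t\left((1+\lambda t)^{\frac{1}{\lambda}}-1\right)}.$$ Then for every polynomial $p(x)\in\mathbb{C}_p[x]$, $$F(t)\int_{\mathbb{Z}_p}p(x+y)\,d\mu_0(y)=F(t)\int_{\mathbb{Z}_p}e^{yt}p(x)\,d\mu_0(y)=G(t)p(x).$$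
   Context: $\mathrm{Li}_k(x)=\sum_{n\ge1}x^n/n^k$ is the polylogarithm. Power series are formal in $t$ over $\mathbb{C}_p$; $(1+\lambda t)^{1/\lambda}$ means $\exp\left(\frac1\lambda\log(1+\lambda t)\right)$. A power series $f(t)=\sum_k a_k\frac{t^k}{k!}$ acts on polynomials in $x$ as a linear operator via $t^kp(x)=\frac{d^k}{dx^k}p(x)$. The $p$-adic invariant integral is $\int_{\mathbb{Z}_p}f(y)\,d\mu_0(y)=\lim_{N\to\infty}p^{-N}\sum_{y=0}^{p^N-1}f(y)$. $\int_{\mathbb{Z}_p}p(x+y)\,d\mu_0(y)$ is the polynomial in $x$ obtained by integrating in $y$; $\int_{\mathbb{Z}_p}e^{yt}p(x)\,d\mu_0(y)$ denotes the operator $\sum_{n\ge0}\left(\int_{\mathbb{Z}_p}y^nd\mu_0(y)\right)\frac{t^n}{n!}$ applied to $p(x)$. In each expression the operator $F(t)$ is applied to the resulting polynomial in $x$. *)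

theory Defs
  imports
    "HOL-Analysis.Analysis"
    "HOL-Computational_Algebra.Computational_Algebra"
begin

text \<open>
  The field of \<open>p\<close>-adic complex numbers is only determined up to isometric isomorphism. It is
  rendered as a field type with a metric, subject to a predicate saying that the type is a
  completion of an algebraic closure of \<open>\<rat>\<^sub>p\<close>. The absolute value of \<open>x\<close> is \<open>dist x 0\<close>.
\<close>

definition padic_abs :: "nat \<Rightarrow> rat \<Rightarrow> real" where
  "padic_abs p r =
     (if r = 0 then 0
      else real p powi (int (multiplicity (int p) (snd (quotient_of r)))
                      - int (multiplicity (int p) (fst (quotient_of r)))))"

definition subfield_set :: "'a::field set \<Rightarrow> bool" where
  "subfield_set K \<longleftrightarrow>
     0 \<in> K \<and> 1 \<in> K \<and>
     (\<forall>x\<in>K. \<forall>y\<in>K. x - y \<in> K \<and> x * y \<in> K) \<and>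
     (\<forall>x\<in>K. inverse x \<in> K)"

definition poly_over :: "'a::field set \<Rightarrow> 'a poly \<Rightarrow> bool" where
  "poly_over K f \<longleftrightarrow> (\<forall>i. coeff f i \<in> K)"

definition is_algebraic_closure :: "'a::field set \<Rightarrow> 'a set \<Rightarrow> bool" where
  "is_algebraic_closure K A \<longleftrightarrow>
     subfield_set K \<and> subfield_set A \<and> K \<subseteq> A \<and>
     (\<forall>x\<in>A. \<exists>f. f \<noteq> 0 \<and> poly_over K f \<and> poly f x = 0) \<and>
     (\<forall>f. poly_over A f \<and> degree f > 0 \<longrightarrow> (\<exists>x\<in>A. poly f x = 0))"

text \<open>
  Inside a complete field whose absolute value extends the \<open>p\<close>-adic one on \<open>\<rat>\<close>, the topological
  closure of \<open>\<rat>\<close> is a completion of \<open>\<rat>\<close>, that is, \<open>\<rat>\<^sub>p\<close>.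
\<close>

definition padic_complex_field :: "nat \<Rightarrow> 'a::{field_char_0, metric_space} itself \<Rightarrow> bool" where
  "padic_complex_field p _ \<longleftrightarrow>
     (\<forall>x y z :: 'a. dist (x + z) (y + z) = dist x y) \<and>
     (\<forall>x y :: 'a. dist (x * y) 0 = dist x 0 * dist y 0) \<and>
     (\<forall>r. dist (of_rat r :: 'a) 0 = padic_abs p r) \<and>
     complete (UNIV :: 'a set) \<and>
     (\<exists>A :: 'a set. is_algebraic_closure (closure \<rat>) A \<and> closure A = UNIV)"

text \<open>
  The integrand is a function on \<open>\<int>\<^sub>p\<close>, here the restriction of a function on the whole field;
  only its values at natural numbers enter.
\<close>

definition padic_integral ::
    "nat \<Rightarrow> ('a::{field_char_0, metric_space} \<Rightarrow> 'a) \<Rightarrow> 'a" where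
  "padic_integral p f = lim (\<lambda>N. inverse (of_nat p ^ N) * (\<Sum>y<p ^ N. f (of_nat y)))"

definition padic_integral_shift ::
    "nat \<Rightarrow> 'a::{field_char_0, metric_space} poly \<Rightarrow> 'a poly" where
  "padic_integral_shift p q =
     (THE r. \<forall>x. poly r x = padic_integral p (\<lambda>y. poly q (x + y)))"

definition padic_integral_exp :: "nat \<Rightarrow> 'a::{field_char_0, metric_space} fps" where
  "padic_integral_exp p = Abs_fps (\<lambda>n. padic_integral p (\<lambda>y. y ^ n) / fact n)"

text \<open>
  For \<open>f = (\<Sum>k. a\<^sub>k t^k / k!)\<close> the coefficient \<open>fps_nth f k\<close> is \<open>a\<^sub>k / k!\<close>, and derivatives of order
  above the degree vanish.
\<close>

definition umbral_op :: "'a::field_char_0 fps \<Rightarrow> 'a poly \<Rightarrow> 'a poly" where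
  "umbral_op f q = (\<Sum>k\<le>degree q. smult (fps_nth f k) ((pderiv ^^ k) q))"

definition fps_polylog :: "int \<Rightarrow> 'a::field_char_0 fps" where
  "fps_polylog k = Abs_fps (\<lambda>n. if n = 0 then 0 else 1 / of_nat n powi k)"

text \<open>\<open>(1 + \<lambda>t)\<^sup>a = exp (a log (1 + \<lambda>t))\<close>\<close>

definition fps_one_plus_pow :: "'a::field_char_0 \<Rightarrow> 'a \<Rightarrow> 'a fps" where
  "fps_one_plus_pow lam a =
     fps_exp 1 oo (fps_const a * (fps_ln 1 oo (fps_const lam * fps_X)))"

definition G_series :: "int \<Rightarrow> 'a::field_char_0 \<Rightarrow> 'a fps" where
  "G_series k lam =
     (fps_polylog k oo (1 - fps_one_plus_pow lam (- 1 / lam))) /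
     (fps_one_plus_pow lam (1 / lam) - 1)"

definition F_series :: "int \<Rightarrow> 'a::field_char_0 \<Rightarrow> 'a fps" where
  "F_series k lam =
     ((fps_exp 1 - 1) * (fps_polylog k oo (1 - fps_one_plus_pow lam (- 1 / lam)))) /
     (fps_X * (fps_one_plus_pow lam (1 / lam) - 1))"

end

theory Submission imports Defs begin

text \<open>
  The series \<open>e\<^bsup>yt\<^esup>\<close> acts as translation by \<open>y\<close>, so the mean of \<open>q (x + y)\<close> over \<open>y < M\<close> is the
  action of \<open>(\<Sum>y<M. e\<^bsup>yt\<^esup>) / M = (e\<^bsup>Mt\<^esup> - 1) / (M (e\<^bsup>t\<^esup> - 1))\<close>. Writing \<open>Q(t) = (e\<^bsup>t\<^esup> - 1) / t\<close>, this
  series is \<open>Q(Mt) / Q(t)\<close>, and its action on \<open>q\<close> is polynomial in \<open>M\<close>. Since \<open>M = p\<^sup>N\<close> tends to \<open>0\<close>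
  \<open>p\<close>-adically, the invariant integral is the action of \<open>1 / Q(t) = t / (e\<^bsup>t\<^esup> - 1)\<close>. Composition
  of operators is multiplication of series, and \<open>F(t) = Q(t) G(t)\<close>.
\<close>

lemma higher_pderiv_eq_0:
  assumes "degree q < n"
  shows "(pderiv ^^ n) q = 0"
  by (rule poly_eqI) (use assms in \<open>simp add: coeff_higher_pderiv coeff_eq_0\<close>)

lemma higher_pderiv_pcompose_shift:
  "(pderiv ^^ n) (pcompose q [:a, 1:]) = pcompose ((pderiv ^^ n) q) [:a, 1:]"
  by (induction n) (simp_all add: pderiv_pcompose pderiv_pCons)

lemma coeff_pcompose_shift:
  fixes q :: "'a::field_char_0 poly"
  shows "coeff (pcompose q [:a, 1:]) n = poly ((pderiv ^^ n) q) a / fact n"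
proof -
  have "fact n * coeff (pcompose q [:a, 1:]) n = coeff ((pderiv ^^ n) (pcompose q [:a, 1:])) 0"
    by (simp add: coeff_higher_pderiv pochhammer_fact)
  also have "\<dots> = poly ((pderiv ^^ n) q) a"
    by (simp add: higher_pderiv_pcompose_shift poly_pcompose flip: poly_0_coeff_0)
  finally show ?thesis
    by (simp add: field_simps)
qed

lemma smult_sum_right: "smult c (\<Sum>i\<in>A. f i) = (\<Sum>i\<in>A. smult c (f i))"
  by (induction A rule: infinite_finite_induct) (simp_all add: smult_add_right)

lemma umbral_op_altdef:
  assumes "degree q \<le> n"
  shows "umbral_op f q = (\<Sum>k\<le>n. smult (fps_nth f k) ((pderiv ^^ k) q))"
  unfolding umbral_op_def
  by (rule sum.mono_neutral_left) (use assms in \<open>auto simp: higher_pderiv_eq_0\<close>)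

lemma degree_umbral_op_le: "degree (umbral_op f q) \<le> degree q"
  unfolding umbral_op_def
proof (rule degree_sum_le)
  fix k
  show "degree (smult (fps_nth f k) ((pderiv ^^ k) q)) \<le> degree q"
    using degree_smult_le[of "fps_nth f k" "(pderiv ^^ k) q"] by (simp add: degree_higher_pderiv)
qed simp

lemma higher_pderiv_umbral_op: "(pderiv ^^ n) (umbral_op f q) = umbral_op f ((pderiv ^^ n) q)"
proof -
  have "(pderiv ^^ n) ((pderiv ^^ k) q) = (pderiv ^^ k) ((pderiv ^^ n) q)" for k
    by (metis add.commute comp_apply funpow_add)
  then have "(pderiv ^^ n) (umbral_op f q) =
      (\<Sum>k\<le>degree q. smult (fps_nth f k) ((pderiv ^^ k) ((pderiv ^^ n) q)))"
    by (simp add: umbral_op_def higher_pderiv_sum higher_pderiv_smult)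
  also have "\<dots> = umbral_op f ((pderiv ^^ n) q)"
    by (rule umbral_op_altdef[symmetric]) (simp add: degree_higher_pderiv)
  finally show ?thesis .
qed

lemma umbral_op_mult: "umbral_op f (umbral_op g q) = umbral_op (f * g) q"
proof -
  define n where "n = degree q"
  define summand where "summand i j = smult (fps_nth f i * fps_nth g j) ((pderiv ^^ (j + i)) q)" for i j
  have "umbral_op f (umbral_op g q) = (\<Sum>i\<le>n. smult (fps_nth f i) (umbral_op g ((pderiv ^^ i) q)))"
    by (simp add: umbral_op_altdef[OF degree_umbral_op_le] higher_pderiv_umbral_op n_def)
  also have "\<dots> = (\<Sum>i\<le>n. \<Sum>j\<le>n - i. summand i j)"
    by (simp add: umbral_op_def degree_higher_pderiv smult_sum_right summand_def n_def
        funpow_add)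
  also have "\<dots> = (\<Sum>(i, j)\<in>(SIGMA i:{..n}. {..n - i}). summand i j)"
    by (simp add: sum.Sigma)
  also have "(SIGMA i:{..n}. {..n - i}) = {(i, j). i + j \<le> n}"
    by auto
  also have "(\<Sum>(i, j)\<in>{(i, j). i + j \<le> n}. summand i j) = (\<Sum>k\<le>n. \<Sum>i\<le>k. summand i (k - i))"
    by (rule sum.triangle_reindex_eq)
  also have "\<dots> = umbral_op (f * g) q"
    by (simp add: umbral_op_def n_def summand_def fps_mult_nth smult_sum atLeast0AtMost)
  finally show ?thesis .
qed

lemma umbral_op_sum_left: "umbral_op (\<Sum>i\<in>A. f i) q = (\<Sum>i\<in>A. umbral_op (f i) q)"
  unfolding umbral_op_def fps_sum_nth smult_sum by (rule sum.swap)

lemma umbral_op_const_mult: "umbral_op (fps_const c * f) q = smult c (umbral_op f q)"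
  by (simp add: umbral_op_def smult_sum_right)

lemma umbral_op_fps_exp: "umbral_op (fps_exp a) q = pcompose q [:a, 1:]"
proof (rule poly_ext)
  fix x
  have "poly (pcompose q [:a, 1:]) x = poly (pcompose q [:x, 1:]) a"
    by (simp add: poly_pcompose add.commute)
  also have "\<dots> = (\<Sum>k\<le>degree q. poly ((pderiv ^^ k) q) x / fact k * a ^ k)"
    by (simp add: poly_altdef coeff_pcompose_shift degree_pcompose)
  also have "\<dots> = poly (umbral_op (fps_exp a) q) x"
    by (simp add: umbral_op_def poly_sum mult.commute)
  finally show "poly (umbral_op (fps_exp a) q) x = poly (pcompose q [:a, 1:]) x" ..
qed

lemma poly_umbral_op_monom_0: "poly (umbral_op f (monom 1 n)) 0 = fact n * fps_nth f n"
proof -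
  have "poly ((pderiv ^^ k) (monom (1::'a) n)) 0 = (if k = n then fact n else 0)" for k
    by (simp add: poly_0_coeff_0 coeff_higher_pderiv pochhammer_fact)
  then show ?thesis
    by (simp add: umbral_op_def poly_sum degree_monom_eq mult_delta_right)
qed

definition fps_exp_quotient :: "'a::field_char_0 fps" where
  "fps_exp_quotient = (fps_exp 1 - 1) / fps_X"

definition fps_bernoulli :: "'a::field_char_0 fps" where
  "fps_bernoulli = fps_X / (fps_exp 1 - 1)"

lemma fps_nth_exp_quotient: "fps_nth fps_exp_quotient n = 1 / fact (Suc n)"
  by (simp add: fps_exp_quotient_def algebra_simps)

lemma fps_exp_minus_1_eq:
  "fps_exp z - 1 = fps_const z * fps_X * (fps_exp_quotient oo (fps_const z * fps_X))"
proof (rule fps_ext)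
  fix n
  show "fps_nth (fps_exp z - 1) n =
      fps_nth (fps_const z * fps_X * (fps_exp_quotient oo (fps_const z * fps_X))) n"
    by (cases n) (simp_all add: fps_nth_exp_quotient mult.assoc del: fact_Suc)
qed

lemma fps_exp_1_minus_1_eq: "fps_exp 1 - 1 = fps_X * fps_exp_quotient"
  using fps_exp_minus_1_eq[of 1] by simp

lemma fps_exp_quotient_mult_bernoulli: "fps_exp_quotient * fps_bernoulli = (1::'a::field_char_0 fps)"
proof -
  have unit: "fps_nth (fps_exp_quotient :: 'a fps) 0 \<noteq> 0"
    by (simp add: fps_nth_exp_quotient)
  have "(fps_bernoulli :: 'a fps) = (fps_X * 1) / (fps_X * fps_exp_quotient)"
    by (simp add: fps_bernoulli_def fps_exp_1_minus_1_eq)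
  also have "\<dots> = 1 / fps_exp_quotient"
    by (rule div_mult_mult1) simp
  also have "\<dots> = inverse fps_exp_quotient"
    by (simp add: fps_divide_unit[OF unit])
  finally show ?thesis
    using inverse_mult_eq_1'[OF unit] by simp
qed

lemma sum_fps_exp_eq:
  "(\<Sum>y<M. fps_exp (of_nat y :: 'a::field_char_0)) =
     fps_const (of_nat M) * ((fps_exp_quotient oo (fps_const (of_nat M) * fps_X)) * fps_bernoulli)"
  (is "?S = ?M * (?Q * _)")
proof -
  have "fps_X * (fps_exp_quotient * ?S) = (fps_exp 1 - 1) * ?S"
    by (simp add: fps_exp_1_minus_1_eq mult.assoc)
  also have "\<dots> = fps_exp (of_nat M) - 1"
    using power_diff_1_eq[of "fps_exp 1 :: 'a fps" M] by (simp add: fps_exp_power_mult)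
  also have "\<dots> = fps_X * (?M * ?Q)"
    by (subst fps_exp_minus_1_eq) (simp only: mult_ac)
  finally have "fps_exp_quotient * ?S = ?M * ?Q"
    by simp
  then have "fps_exp_quotient * fps_bernoulli * ?S = ?M * (?Q * fps_bernoulli)"
    by (simp only: mult_ac)
  then show ?thesis
    by (simp add: fps_exp_quotient_mult_bernoulli)
qed

lemma mean_poly_shift_eq_umbral_op:
  assumes "M \<noteq> 0"
  shows "inverse (of_nat M) * (\<Sum>y<M. poly q (x + of_nat y)) =
    poly (umbral_op (fps_exp_quotient oo (fps_const (of_nat M) * fps_X)) (umbral_op fps_bernoulli q)) x"
proof -
  have "(\<Sum>y<M. poly q (x + of_nat y)) = poly (umbral_op (\<Sum>y<M. fps_exp (of_nat y)) q) x"
    by (simp add: umbral_op_sum_left umbral_op_fps_exp poly_sum poly_pcompose add.commute)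
  also have "\<dots> = of_nat M *
      poly (umbral_op (fps_exp_quotient oo (fps_const (of_nat M) * fps_X)) (umbral_op fps_bernoulli q)) x"
    by (simp add: sum_fps_exp_eq umbral_op_const_mult umbral_op_mult)
  finally show ?thesis
    using assms by simp
qed

locale multiplicative_metric =
  fixes T :: "'a::{comm_ring_1, metric_space} itself"
  assumes dist_add_right: "dist (x + z) (y + z) = dist x (y::'a)"
    and dist_mult_0: "dist (x * y) 0 = dist x 0 * dist y (0::'a)"
begin

lemma dist_conv_dist_0: "dist x y = dist (x - y) (0::'a)"
  using dist_add_right[of x "- y" y] by simp

lemma dist_add_left: "dist (z + x) (z + y) = dist x (y::'a)"
  using dist_add_right[of x z y] by (simp add: add.commute)

lemma dist_mult_right: "dist (x * z) (y * z) = dist x y * dist z (0::'a)"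
  by (metis dist_conv_dist_0 dist_mult_0 left_diff_distrib)

lemma dist_mult_left: "dist (z * x) (z * y) = dist z 0 * dist x (y::'a)"
  by (metis dist_mult_right mult.commute)

lemma dist_power_0: "dist (x ^ n) 0 = dist x (0::'a) ^ n"
proof (induction n)
  case 0
  show ?case
    using dist_mult_0[of 1 1] by simp
qed (simp add: dist_mult_0)

lemma tendsto_add_metric:
  fixes a b :: 'a
  assumes "(f \<longlongrightarrow> a) F" and "(g \<longlongrightarrow> b) F"
  shows "((\<lambda>i. f i + g i) \<longlongrightarrow> a + b) F"
proof -
  have "dist (f i + g i) (a + b) \<le> dist (f i) a + dist (g i) b" for i
    using dist_triangle[of "f i + g i" "a + b" "a + g i"] by (simp add: dist_add_left dist_add_right)
  moreover have "((\<lambda>i. dist (f i) a + dist (g i) b) \<longlongrightarrow> 0) F"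
    using assms[THEN tendsto_dist_iff[THEN iffD1]] by (rule tendsto_add_zero)
  ultimately show ?thesis
    by (elim metric_tendsto_imp_tendsto) (simp add: dist_real_def)
qed

lemma tendsto_mult_metric:
  fixes a b :: 'a
  assumes "(f \<longlongrightarrow> a) F" and "(g \<longlongrightarrow> b) F"
  shows "((\<lambda>i. f i * g i) \<longlongrightarrow> a * b) F"
proof -
  have "dist (f i * g i) (a * b) \<le> dist (f i) 0 * dist (g i) b + dist (f i) a * dist b 0" for i
    using dist_triangle[of "f i * g i" "a * b" "f i * b"] by (simp add: dist_mult_left dist_mult_right)
  moreover have "((\<lambda>i. dist (f i) 0 * dist (g i) b + dist (f i) a * dist b 0)
      \<longlongrightarrow> dist a 0 * dist b b + dist a a * dist b 0) F"
    by (intro tendsto_intros assms)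
  then have "((\<lambda>i. dist (f i) 0 * dist (g i) b + dist (f i) a * dist b 0) \<longlongrightarrow> 0) F"
    by simp
  ultimately show ?thesis
    by (elim metric_tendsto_imp_tendsto) (simp add: dist_real_def)
qed

lemma tendsto_poly_metric:
  fixes a :: 'a
  assumes "(f \<longlongrightarrow> a) F"
  shows "((\<lambda>i. poly r (f i)) \<longlongrightarrow> poly r a) F"
  by (induction r) (simp_all add: assms tendsto_add_metric tendsto_mult_metric)

end

lemma tendsto_umbral_op_compose_linear:
  fixes z :: "'i \<Rightarrow> 'a::{field_char_0, metric_space}"
  assumes "multiplicative_metric TYPE('a)" and "(z \<longlongrightarrow> 0) F"
  shows "((\<lambda>i. poly (umbral_op (f oo (fps_const (z i) * fps_X)) q) x) \<longlongrightarrow> fps_nth f 0 * poly q x) F"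
proof -
  define r where "r = (\<Sum>k\<le>degree q. monom (fps_nth f k * poly ((pderiv ^^ k) q) x) k)"
  have "poly (umbral_op (f oo (fps_const c * fps_X)) q) x = poly r c" for c
    unfolding umbral_op_def r_def poly_sum poly_smult poly_monom fps_nth_compose_linear
    by (simp add: mult_ac)
  moreover have "((\<lambda>i. poly r (z i)) \<longlongrightarrow> poly r 0) F"
    using assms by (rule multiplicative_metric.tendsto_poly_metric)
  moreover have "poly r 0 = fps_nth f 0 * poly q x"
    by (simp add: r_def poly_0_coeff_0 coeff_sum)
  ultimately show ?thesis
    by simp
qed

lemma tendsto_mean_poly_shift:
  fixes x :: "'a::{field_char_0, metric_space}"
  assumes "multiplicative_metric TYPE('a)"
    and "((\<lambda>i. of_nat (M i) :: 'a) \<longlongrightarrow> 0) F" and "\<And>i. M i \<noteq> 0"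
  shows "((\<lambda>i. inverse (of_nat (M i)) * (\<Sum>y<M i. poly q (x + of_nat y)))
    \<longlongrightarrow> poly (umbral_op fps_bernoulli q) x) F"
  using tendsto_umbral_op_compose_linear
    [OF assms(1,2), of fps_exp_quotient "umbral_op fps_bernoulli q" x]
  by (simp add: mean_poly_shift_eq_umbral_op assms(3) fps_nth_exp_quotient)

lemma padic_abs_prime:
  assumes "prime p"
  shows "padic_abs p (of_nat p) = 1 / real p"
proof -
  have "quotient_of (of_nat p) = (int p, 1)"
    using quotient_of_int[of "int p"] by (simp flip: Rat.of_int_def)
  moreover have "multiplicity (int p) (int p) = 1"
    using assms by (intro multiplicity_self) (auto simp: prime_gt_0_nat)
  ultimately show ?thesis
    using assms by (simp add: padic_abs_def power_int_minus divide_inverse prime_gt_0_nat)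
qed

context
  fixes p :: nat
  assumes prime_p: "prime p"
    and padic_p: "padic_complex_field p TYPE('a::{field_char_0, metric_space})"
begin

interpretation multiplicative_metric "TYPE('a)"
  using padic_p by unfold_locales (simp_all add: padic_complex_field_def)

lemma padic_prime_power_tendsto_0: "(\<lambda>N. of_nat (p ^ N) :: 'a) \<longlonglongrightarrow> 0"
proof -
  have "dist (of_rat (of_nat p) :: 'a) 0 = padic_abs p (of_nat p)"
    using padic_p unfolding padic_complex_field_def by blast
  then have "dist (of_nat p :: 'a) 0 = 1 / real p"
    using prime_p by (simp add: padic_abs_prime)
  moreover have "(\<lambda>N. (1 / real p) ^ N) \<longlonglongrightarrow> 0"
    using prime_gt_1_nat[OF prime_p] by (intro LIMSEQ_power_zero) simp
  ultimately show ?thesis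
    by (subst tendsto_dist_iff) (simp add: dist_power_0)
qed

lemma padic_integral_poly_shift:
  "padic_integral p (\<lambda>y. poly q (x + y)) = poly (umbral_op fps_bernoulli q) (x :: 'a)"
proof -
  have "p ^ N \<noteq> 0" for N
    using prime_p by auto
  then show ?thesis
    using tendsto_mean_poly_shift[OF multiplicative_metric_axioms padic_prime_power_tendsto_0]
    by (simp add: padic_integral_def limI)
qed

lemma padic_integral_shift_eq: "padic_integral_shift p q = umbral_op fps_bernoulli (q :: 'a poly)"
  unfolding padic_integral_shift_def padic_integral_poly_shift
  by (rule the_equality) (auto intro: poly_ext)

lemma padic_integral_exp_eq: "padic_integral_exp p = (fps_bernoulli :: 'a fps)"
proof (rule fps_ext)
  fix n
  have "padic_integral p (\<lambda>y. y ^ n) = fact n * fps_nth (fps_bernoulli :: 'a fps) n"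
    using padic_integral_poly_shift[of "monom 1 n" 0] by (simp add: poly_monom poly_umbral_op_monom_0)
  then show "fps_nth (padic_integral_exp p) n = fps_nth (fps_bernoulli :: 'a fps) n"
    by (simp add: padic_integral_exp_def)
qed

end

lemma fps_dvd_if_nth_1_nonzero:
  fixes f g :: "'a::field fps"
  assumes "fps_nth f 1 \<noteq> 0" and "fps_nth g 0 = 0"
  shows "f dvd g"
proof (cases "g = 0")
  case False
  have "subdegree f \<le> 1"
    using assms(1) by (rule subdegree_leI)
  also have "1 \<le> subdegree g"
    using False assms(2) by (intro subdegree_geI) auto
  finally show ?thesis
    using False assms(1) by (subst fps_dvd_iff) auto
qed simp

lemma fps_one_plus_pow_nth_1: "fps_nth (fps_one_plus_pow lam a) 1 = a * lam"
  by (simp add: fps_one_plus_pow_def fps_compose_nth fps_ln_nth)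

lemma F_series_eq:
  fixes lam :: "'a::field_char_0"
  assumes "lam \<noteq> 0"
  shows "F_series k lam = fps_exp_quotient * G_series k lam"
proof -
  define L where "L = fps_polylog k oo (1 - fps_one_plus_pow lam (- 1 / lam))"
  define D where "D = fps_one_plus_pow lam (1 / lam) - 1"
  have "fps_nth D 1 = 1"
    using assms by (simp only: D_def fps_sub_nth fps_one_plus_pow_nth_1) simp
  moreover have "fps_nth L 0 = 0"
    by (simp add: L_def fps_polylog_def)
  ultimately have "D dvd L"
    by (simp add: fps_dvd_if_nth_1_nonzero)
  have "F_series k lam = (fps_X * (fps_exp_quotient * L)) / (fps_X * D)"
    by (simp add: F_series_def L_def D_def fps_exp_1_minus_1_eq mult.assoc)
  also have "\<dots> = (fps_exp_quotient * L) / D"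
    by (rule div_mult_mult1) simp
  also have "\<dots> = fps_exp_quotient * (L / D)"
    using \<open>D dvd L\<close> by (simp add: div_mult_swap)
  finally show ?thesis
    by (simp add: G_series_def L_def D_def)
qed

lemma F_series_mult_bernoulli:
  fixes lam :: "'a::field_char_0"
  assumes "lam \<noteq> 0"
  shows "F_series k lam * fps_bernoulli = G_series k lam"
proof -
  have "F_series k lam * fps_bernoulli = (fps_exp_quotient * fps_bernoulli) * G_series k lam"
    by (simp only: F_series_eq[OF assms] mult_ac)
  then show ?thesis
    by (simp add: fps_exp_quotient_mult_bernoulli)
qed

theorem theorem2:
  fixes p :: nat and k :: int
    and lam :: "'a::{field_char_0, metric_space}" and q :: "'a poly"
  assumes "prime p"
    and "padic_complex_field p TYPE('a)"
    and "lam \<noteq> 0"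
  shows "umbral_op (F_series k lam) (padic_integral_shift p q) =
           umbral_op (F_series k lam) (umbral_op (padic_integral_exp p) q) \<and>
         umbral_op (F_series k lam) (umbral_op (padic_integral_exp p) q) =
           umbral_op (G_series k lam) q"
proof -
  have shift_eq: "padic_integral_shift p q = umbral_op fps_bernoulli q"
    using assms by (simp add: padic_integral_shift_eq)
  have exp_eq: "padic_integral_exp p = (fps_bernoulli :: 'a fps)"
    using assms by (simp add: padic_integral_exp_eq)
  have "umbral_op (F_series k lam) (umbral_op fps_bernoulli q) = umbral_op (G_series k lam) q"
    using assms by (simp add: umbral_op_mult F_series_mult_bernoulli)
  then show ?thesis
    by (simp add: shift_eq exp_eq)
qed

end
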